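(* Let $(X,d)$ be a metric space, $\zeta$ a simulation function, $x_0\in X$, and $T:X\to X$ a Ćirić type $\mathcal{Z}_c$-contraction with respect to $\zeta$ with $x_0$. Let $\rho=\inf_{x\in X}\{d(x,Tx)\mid Tx\neq x\}$. If the condition $0<d(Tx,x_0)\leq\rho$ holds for all $x\in D_{x_0,\rho}\setminus\{x_0\}$, then $D_{x_0,\rho}$ is a fixed disc of $T$.
   Context: A function $\zeta:[0,\infty)^2\to\mathbb{R}$ is a simulation function if: $(\zeta_1)$ $\zeta(0,0)=0$; $(\zeta_2)$ $\zeta(t,s)<s-t$ for all $s,t>0$; $(\zeta_3)$ if $\{t_n\},\{s_n\}$ are sequences in $(0,\infty)$ with $\lim_{n\to\infty}t_n=\lim_{n\to\infty}s_n>0$, then $\limsup_{n\to\infty}\zeta(t_n,s_n)<0$. For $x,y\in X$ put $$m^{\ast}(x,y)=\max\left\{d(x,y),\,d(x,Tx),\,d(y,Ty),\,\frac{d(x,Ty)+d(y,Tx)}{2}\right\}.$$ $T$ is a Ćirić type $\mathcal{Z}_c$-contraction with respect to $\zeta$ with $x_0$ if for all $x\in X$: $d(Tx,x)>0\Rightarrow\zeta\left(d(Tx,x),m^{\ast}(x,x_0)\right)\geq 0$. For $r\in[0,\infty)$, $D_{x_0,r}=\{x\in X: d(x,x_0)\leq r\}$. The disc $D_{x_0,r}$ is called a fixed disc of $T$ if $Tx=x$ for all $x\in D_{x_0,r}$. The number $\rho$ is taken to be an element of $[0,\infty)$. *)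

theory Defs
  imports "HOL-Analysis.Analysis"
begin

text \<open>
  A simulation function is a function on \<open>[0,\<infinity>)\<^sup>2\<close>; here it is a total function on the
  reals of which only the values at nonnegative arguments are constrained or used. The limit superior
  is taken in the extended reals, since the values may be unbounded below.
\<close>

definition simulation_function :: "(real \<Rightarrow> real \<Rightarrow> real) \<Rightarrow> bool" where
  "simulation_function \<zeta> \<longleftrightarrow>
     \<zeta> 0 0 = 0 \<and>
     (\<forall>t>0. \<forall>s>0. \<zeta> t s < s - t) \<and>
     (\<forall>(t :: nat \<Rightarrow> real) (s :: nat \<Rightarrow> real) L.
        (\<forall>n. 0 < t n) \<longrightarrow> (\<forall>n. 0 < s n) \<longrightarrow> t \<longlonglongrightarrow> L \<longrightarrow> s \<longlonglongrightarrow> L \<longrightarrow> 0 < L \<longrightarrow>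
        limsup (\<lambda>n. ereal (\<zeta> (t n) (s n))) < 0)"

definition m_star :: "('a::metric_space \<Rightarrow> 'a) \<Rightarrow> 'a \<Rightarrow> 'a \<Rightarrow> real" where
  "m_star T x y =
     Max {dist x y, dist x (T x), dist y (T y), (dist x (T y) + dist y (T x)) / 2}"

definition ciric_Zc_contraction ::
  "(real \<Rightarrow> real \<Rightarrow> real) \<Rightarrow> 'a::metric_space \<Rightarrow> ('a \<Rightarrow> 'a) \<Rightarrow> bool" where
  "ciric_Zc_contraction \<zeta> x0 T \<longleftrightarrow>
     (\<forall>x. dist (T x) x > 0 \<longrightarrow> \<zeta> (dist (T x) x) (m_star T x x0) \<ge> 0)"

text \<open>The disc of centre \<open>x0\<close> and radius \<open>r\<close> is the closed ball \<open>cball x0 r\<close>.\<close>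

definition fixed_disc :: "('a::metric_space \<Rightarrow> 'a) \<Rightarrow> 'a \<Rightarrow> real \<Rightarrow> bool" where
  "fixed_disc T x0 r \<longleftrightarrow> (\<forall>x\<in>cball x0 r. T x = x)"

end

theory Submission
  imports Defs
begin

text \<open>
  By \<open>\<zeta> t s < s - t\<close>, the contraction condition forces \<open>d(x, Tx) < m\<^sup>*(x, x0)\<close> at every
  point \<open>x\<close> moved by \<open>T\<close>. At \<open>x = x0\<close> the right-hand side is \<open>d(x0, Tx0)\<close>, so \<open>x0\<close> is fixed.
  For any other point of the disc, each term of the maximum is bounded by \<open>\<rho>\<close> or by \<open>d(x, Tx)\<close>,
  and \<open>\<rho> \<le> d(x, Tx)\<close> if \<open>x\<close> is moved; hence no point of the disc is moved.
\<close>

lemma ciric_Zc_contraction_dist_less: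
  assumes "simulation_function \<zeta>" and "ciric_Zc_contraction \<zeta> x0 T" and "T x \<noteq> x"
  shows "dist x (T x) < m_star T x x0"
proof -
  have pos: "0 < dist (T x) x"
    using assms(3) by simp
  \<comment> \<open>This makes the second argument of \<zeta> positive too, as the bound
    \<open>\<zeta> t s < s - t\<close> requires.\<close>
  moreover have "dist (T x) x \<le> m_star T x x0"
    by (simp add: m_star_def dist_commute)
  ultimately have "\<zeta> (dist (T x) x) (m_star T x x0) < m_star T x x0 - dist (T x) x"
    using assms(1) unfolding simulation_function_def by (meson less_le_trans)
  moreover have "0 \<le> \<zeta> (dist (T x) x) (m_star T x x0)"
    using assms(2) pos by (simp add: ciric_Zc_contraction_def)
  ultimately show ?thesis
    by (simp add: dist_commute)
qed

lemma ciric_Zc_contraction_fixes_center: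
  assumes "simulation_function \<zeta>" and "ciric_Zc_contraction \<zeta> x0 T"
  shows "T x0 = x0"
proof (rule ccontr)
  assume "T x0 \<noteq> x0"
  then have "dist x0 (T x0) < m_star T x0 x0"
    by (rule ciric_Zc_contraction_dist_less[OF assms])
  then show False
    by (simp add: m_star_def)
qed

theorem theorem2p15:
  fixes \<zeta> :: "real \<Rightarrow> real \<Rightarrow> real"
    and x0 :: "'a::metric_space"
    and T :: "'a \<Rightarrow> 'a"
    and \<rho> :: real
  assumes "simulation_function \<zeta>"
    and "ciric_Zc_contraction \<zeta> x0 T"
    and "\<rho> = Inf {dist x (T x) |x. T x \<noteq> x}"
    and "\<forall>x\<in>cball x0 \<rho> - {x0}. 0 < dist (T x) x0 \<and> dist (T x) x0 \<le> \<rho>"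
  shows "fixed_disc T x0 \<rho>"
  unfolding fixed_disc_def
proof (intro ballI, rule ccontr)
  fix x
  assume x: "x \<in> cball x0 \<rho>" and moved: "T x \<noteq> x"
  have center: "T x0 = x0"
    using assms(1,2) by (rule ciric_Zc_contraction_fixes_center)
  have "bdd_below {dist x (T x) |x. T x \<noteq> x}"
    by (rule bdd_belowI[of _ 0]) auto
  \<comment> \<open>The moved point \<open>x\<close> puts \<open>dist x (T x)\<close> into the set,
    so \<open>Inf\<close> is not taken at the empty set, where its value is unspecified.\<close>
  then have "\<rho> \<le> dist x (T x)"
    unfolding assms(3) using moved by (intro cInf_lower) auto
  moreover have "dist x x0 \<le> \<rho>"
    using x by (simp add: dist_commute)
  \<comment> \<open>The hypothesis on the disc excludes \<open>x0\<close>; it applies since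
    \<open>x\<close> is moved and \<open>x0\<close> is fixed.\<close>
  moreover have "dist (T x) x0 \<le> \<rho>"
    using assms(4) x moved center by auto
  \<comment> \<open>As \<open>T x0 = x0\<close>, the third term is 0 and the last is the mean of two
    distances that are at most \<rho>.\<close>
  ultimately have "m_star T x x0 \<le> dist x (T x)"
    by (simp add: m_star_def center dist_commute)
  with ciric_Zc_contraction_dist_less[OF assms(1,2) moved] show False
    by simp
qed

end
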